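(* Let $\kappa$ be an infinite cardinal, let $\{X_j\}_{j\in J}$ be a family of non-empty topological spaces, and put $X:=\prod_{j\in J}X_j$ (with the product topology). Then: (a) $\sup_{j\in J}kw(X_j)\leq kw(X)\leq |J|\sup_{j\in J}kw(X_j)$; and (b) if $X_j$ has a $\kappa$-sock for every $j\in J$, then $X$ has a $\kappa$-sock.
   Context: All spaces are assumed to be Tychonoff (completely regular Hausdorff). $\mathscr{C}(X,Y)$ denotes the space of continuous functions from $X$ to $Y$ with the compact-open topology. $\mathscr{K}(X)$ is the poset of compact subsets of $X$ ordered by inclusion. The compact weight of $X$ is $kw(X):=\sup\{w(K)\mid K\in\mathscr{K}(X)\}$, where $w(K)$ is the weight of $K$, with the convention $kw(K)=w(K)=\aleph_0$ if $K$ is finite. A directed set $(\mathbb{I},\leq)$ is $\kappa$-long if every subset $C\subseteq\mathbb{I}$ with $|C|\leq\kappa$ has an upper bound in $\mathbb{I}$. A poset is an $\omega$-cpo if every non-decreasing sequence $\{\alpha_k\}_{k<\omega}$ in it has a supremum. A $\kappa$-sock on $X$ is a family $\{p_\alpha\}_{\alpha\in\mathbb{I}}$ of retracts on $X$ (continuous maps $p_\alpha\colon X\to X$ with $p_\alpha p_\alpha=p_\alpha$), indexed by a $\kappa$-long $\omega$-cpo $(\mathbb{I},\leq)$, such that: (S1) $K_\alpha:=p_\alpha(X)$ is compact for every $\alpha\in\mathbb{I}$; (S2) $p_\beta p_\alpha=p_\alpha$ (equivalently, $K_\alpha\subseteq K_\beta$) whenever $\alpha\leq\beta$; (S3) $\{K_\alpha\}_{\alpha\in\mathbb{I}}$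 is cofinal in $\mathscr{K}(X)$; (S4) for every non-decreasing sequence $\{\alpha_k\}_{k<\omega}$ in $\mathbb{I}$ with $\gamma=\sup_{k<\omega}\alpha_k$, one has $\lim p_{\alpha_k}=p_\gamma$ in $\mathscr{C}(X,K_\gamma)$.
   Formalization: The upper bound kw(X) ≤ |J| sup kw(X_j) in (a) is stated only for non-empty J; for empty J the product is a point with kw(X) = ℵ₀ while the right-hand side is 0, so the inequality fails there. *)

theory Defs
  imports "HOL-Analysis.Analysis"
begin

unbundle cardinal_syntax

definition tychonoff_space :: "'a topology \<Rightarrow> bool" where
  "tychonoff_space X \<longleftrightarrow> completely_regular_space X \<and> Hausdorff_space X"


section \<open>Cardinals, weight and compact weight\<close>

text \<open>
  Cardinals are those of the library: well-orders satisfying \<^const>\<open>Card_order\<close>, compared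
  (also across types) by \<open>\<le>o\<close> and determined up to \<open>=o\<close>.
\<close>

definition least_card :: "'b rel set \<Rightarrow> 'b rel" where
  "least_card R = (SOME r. r \<in> R \<and> (\<forall>s\<in>R. r \<le>o s))"

text \<open>
  The supremum of a set of cardinals on a type \<open>'b\<close>. Since \<open>|UNIV :: 'b set|\<close> is always an
  upper bound, restricting to upper bounds on \<open>'b\<close> loses nothing: the result is the least among
  the cardinal upper bounds on all types, see \<open>card_sup_least\<close> below.
\<close>

definition card_sup :: "'b rel set \<Rightarrow> 'b rel" where
  "card_sup R = least_card {r. Card_order r \<and> (\<forall>s\<in>R. s \<le>o r)}"

lemma least_card:
  assumes "R \<noteq> {}" and "\<And>r. r \<in> R \<Longrightarrow> Card_order r"
  shows "least_card R \<in> R" and "s \<in> R \<Longrightarrow> least_card R \<le>o s"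
proof -
  have "\<exists>r. r \<in> R \<and> (\<forall>s\<in>R. r \<le>o s)"
    using exists_minim_Card_order[of R] assms by blast
  from someI_ex[OF this] show "least_card R \<in> R" and "s \<in> R \<Longrightarrow> least_card R \<le>o s"
    unfolding least_card_def by blast+
qed

lemma
  fixes R :: "'b rel set"
  assumes R: "\<And>r. r \<in> R \<Longrightarrow> Card_order r"
  shows Card_order_card_sup: "Card_order (card_sup R)"
    and card_sup_upper: "\<And>s. s \<in> R \<Longrightarrow> s \<le>o card_sup R"
    and card_sup_least: "\<And>t :: 'c rel. Card_order t \<Longrightarrow> (\<And>s. s \<in> R \<Longrightarrow> s \<le>o t) \<Longrightarrow> card_sup R \<le>o t"
proof -
  let ?U = "{r :: 'b rel. Card_order r \<and> (\<forall>s\<in>R. s \<le>o r)}"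
  have top: "s \<le>o |UNIV :: 'b set|" if "Card_order s" for s :: "'b rel"
    using that by (metis card_of_Field_ordIso card_of_mono1 ordIso_ordLeq_trans ordIso_symmetric subset_UNIV)
  then have U: "|UNIV :: 'b set| \<in> ?U"
    using R by (auto simp: card_of_Card_order)
  then have mem: "card_sup R \<in> ?U" and least: "\<And>s. s \<in> ?U \<Longrightarrow> card_sup R \<le>o s"
    unfolding card_sup_def using least_card[of ?U] by blast+
  show "Card_order (card_sup R)" and "\<And>s. s \<in> R \<Longrightarrow> s \<le>o card_sup R"
    using mem by auto
  fix t :: "'c rel"
  assume t: "Card_order t" and ub: "\<And>s. s \<in> R \<Longrightarrow> s \<le>o t"
  show "card_sup R \<le>o t"
  proof (cases "|UNIV :: 'b set| \<le>o t")
    case True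
    then show ?thesis using least[OF U] ordLeq_transitive by blast
  next
    case False
    then have "t \<le>o |UNIV :: 'b set|"
      using t by (meson card_of_Well_order card_order_on_well_order_on ordLeq_total)
    then have "|Field t| \<le>o |UNIV :: 'b set|"
      using t card_of_Field_ordIso ordIso_ordLeq_trans by blast
    then obtain f :: "'c \<Rightarrow> 'b" where f: "inj_on f (Field t)"
      by (meson card_of_ordLeq)
    have iso: "|f ` Field t| =o t"
      using f t by (meson card_of_Field_ordIso card_of_ordIsoI inj_on_imp_bij_betw ordIso_symmetric ordIso_transitive)
    then have "|f ` Field t| \<in> ?U"
      using ub by (auto simp: card_of_Card_order intro: ordLeq_ordIso_trans ordIso_symmetric)
    then show ?thesis using least iso ordLeq_ordIso_trans by blast
  qed
qed

definition base_of :: "'a topology \<Rightarrow> 'a set set \<Rightarrow> bool" where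
  "base_of X \<B> \<longleftrightarrow> (\<forall>V\<in>\<B>. openin X V) \<and>
     (\<forall>U x. openin X U \<and> x \<in> U \<longrightarrow> (\<exists>V\<in>\<B>. x \<in> V \<and> V \<subseteq> U))"

text \<open>
  The left summand carries the bases; the right one makes room for \<open>\<aleph>\<^sub>0\<close>, the conventional
  weight of a finite space, which need not exist on \<open>'a set\<close>.
\<close>

definition weight :: "'a topology \<Rightarrow> ('a set + nat) rel" where
  "weight X = (if finite (topspace X) then |range Inr|
               else least_card {|Inl ` \<B>| |\<B>. base_of X \<B>})"

definition compact_weight :: "'a topology \<Rightarrow> ('a set + nat) rel" where
  "compact_weight X = card_sup {weight (subtopology X K) |K. compactin X K}"


section \<open>Spaces of continuous functions\<close>

text \<open>
  As in \<^const>\<open>product_topology\<close>, functions on a space are represented by HOL functions that are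
  \<^const>\<open>undefined\<close> outside it.
\<close>

definition cont_maps :: "'a topology \<Rightarrow> 'b topology \<Rightarrow> ('a \<Rightarrow> 'b) set" where
  "cont_maps X Y = {f \<in> extensional (topspace X). continuous_map X Y f}"

text \<open>The subbasic set with \<open>K = {}\<close> makes all of \<^const>\<open>cont_maps\<close> the underlying set.\<close>

definition compact_open_topology :: "'a topology \<Rightarrow> 'b topology \<Rightarrow> ('a \<Rightarrow> 'b) topology" where
  "compact_open_topology X Y = topology_generated_by
     {{f \<in> cont_maps X Y. f ` K \<subseteq> U} |K U. compactin X K \<and> openin Y U}"

lemma topspace_compact_open_topology: "topspace (compact_open_topology X Y) = cont_maps X Y"
proof -
  have "cont_maps X Y = {f \<in> cont_maps X Y. f ` {} \<subseteq> {}} \<and> compactin X {} \<and> openin Y {}"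
    by simp
  then show ?thesis
    unfolding compact_open_topology_def topology_generated_by_topspace by blast
qed

definition retracts :: "'a topology \<Rightarrow> ('a \<Rightarrow> 'a) set" where
  "retracts X = {p \<in> cont_maps X X. \<forall>x\<in>topspace X. p (p x) = p x}"


section \<open>Socks\<close>

text \<open>A poset is a carrier \<open>I\<close> with a relation \<open>r\<close> such that \<^term>\<open>partial_order_on I r\<close>.\<close>

definition directed :: "'i set \<Rightarrow> 'i rel \<Rightarrow> bool" where
  "directed I r \<longleftrightarrow> I \<noteq> {} \<and> (\<forall>x\<in>I. \<forall>y\<in>I. \<exists>z\<in>I. (x, z) \<in> r \<and> (y, z) \<in> r)"

definition long :: "'k rel \<Rightarrow> 'i set \<Rightarrow> 'i rel \<Rightarrow> bool" where
  "long \<kappa> I r \<longleftrightarrow> directed I r \<and>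
     (\<forall>C\<subseteq>I. |C| \<le>o \<kappa> \<longrightarrow> (\<exists>u\<in>I. \<forall>c\<in>C. (c, u) \<in> r))"

definition nondecreasing_seq :: "'i set \<Rightarrow> 'i rel \<Rightarrow> (nat \<Rightarrow> 'i) \<Rightarrow> bool" where
  "nondecreasing_seq I r a \<longleftrightarrow> range a \<subseteq> I \<and> (\<forall>m n. m \<le> n \<longrightarrow> (a m, a n) \<in> r)"

definition supremum_of :: "'i set \<Rightarrow> 'i rel \<Rightarrow> 'i set \<Rightarrow> 'i \<Rightarrow> bool" where
  "supremum_of I r S s \<longleftrightarrow> s \<in> I \<and> (\<forall>x\<in>S. (x, s) \<in> r) \<and>
     (\<forall>u\<in>I. (\<forall>x\<in>S. (x, u) \<in> r) \<longrightarrow> (s, u) \<in> r)"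

definition omega_cpo :: "'i set \<Rightarrow> 'i rel \<Rightarrow> bool" where
  "omega_cpo I r \<longleftrightarrow> partial_order_on I r \<and>
     (\<forall>a. nondecreasing_seq I r a \<longrightarrow> (\<exists>s. supremum_of I r (range a) s))"

definition sock :: "'k rel \<Rightarrow> 'a topology \<Rightarrow> 'i set \<Rightarrow> 'i rel \<Rightarrow> ('i \<Rightarrow> 'a \<Rightarrow> 'a) \<Rightarrow> bool" where
  "sock \<kappa> X I r p \<longleftrightarrow>
     long \<kappa> I r \<and> omega_cpo I r \<and>
     (\<forall>\<alpha>\<in>I. p \<alpha> \<in> retracts X) \<and>
     (\<forall>\<alpha>\<in>I. compactin X (p \<alpha> ` topspace X)) \<and>
     (\<forall>\<alpha> \<beta>. (\<alpha>, \<beta>) \<in> r \<longrightarrow> (\<forall>x\<in>topspace X. p \<beta> (p \<alpha> x) = p \<alpha> x)) \<and>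
     (\<forall>L. compactin X L \<longrightarrow> (\<exists>\<alpha>\<in>I. L \<subseteq> p \<alpha> ` topspace X)) \<and>
     (\<forall>a \<gamma>. nondecreasing_seq I r a \<and> supremum_of I r (range a) \<gamma> \<longrightarrow>
        limitin (compact_open_topology X (subtopology X (p \<gamma> ` topspace X)))
          (\<lambda>k. p (a k)) (p \<gamma>) sequentially)"

text \<open>
  HOL cannot quantify over types inside a formula, so the type \<open>'i\<close> in which the index set lives
  is an explicit parameter; the index set itself may be any subset of it.
\<close>

definition has_sock :: "'i itself \<Rightarrow> 'k rel \<Rightarrow> 'a topology \<Rightarrow> bool" where
  "has_sock _ \<kappa> X \<longleftrightarrow> (\<exists>(I :: 'i set) r p. sock \<kappa> X I r p)"

end

theory Submission
  imports Defs
begin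

text \<open>
  Let \<open>P\<close> be the product of the spaces \<open>X j\<close>.

  For the compact weight, everything rests on two facts about \<open>T\<^sub>1\<close> spaces: weight and compact weight
  are monotone under embeddings (\<open>weight_embedding\<close>, \<open>compact_weight_embedding\<close>), and if \<open>J\<close> is not empty
  and all factors have weight at most an infinite cardinal \<open>r\<close>, then the product has weight at most
  \<open>|J| \<cdot> r\<close> (\<open>weight_product_topology\<close>), because the boxes built from bases of the factors are indexed by
  finite sets. Each \<open>X j\<close> embeds into \<open>P\<close> as a
  slice, which gives the lower bound. A compact subset of \<open>P\<close> embeds into the product of its
  projections, which are compact subsets of the factors, and this gives the upper bound
  (\<open>compact_weight_product_topology\<close>).

  For socks, the index set is the product of the index sets of the factors with the coordinatewise
  order, and the retract at \<open>\<alpha>\<close> is the product of the retracts at \<open>\<alpha> j\<close>. Upper bounds and suprema are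
  formed coordinatewise, and so are the images of the retracts. The step with topological content is
  the convergence of the retracts along a nondecreasing sequence: over Hausdorff spaces, a product of
  maps converges in the compact-open topology as soon as each factor does
  (\<open>limitin_compact_open_product_map\<close>).
\<close>


section \<open>Weight\<close>

lemma base_of_open_sets: "base_of X {U. openin X U}"
  unfolding base_of_def by auto

text \<open>
  Only infinite spaces have their weight given by a base, since finite ones are assigned
  \<open>\<aleph>\<^sub>0\<close> by convention. Since cardinals are well-ordered, the minimum is attained.
\<close>

lemma weight_attained:
  fixes X :: "'a topology"
  assumes "infinite (topspace X)"
  obtains \<B> where "base_of X \<B>" and "weight X = |Inl ` \<B> :: ('a set + nat) set|"
proof -
  let ?R = "{|Inl ` \<B> :: ('a set + nat) set| |\<B>. base_of X \<B>}"
  have "least_card ?R \<in> ?R"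
  proof (rule least_card(1))
    show "?R \<noteq> {}"
      using base_of_open_sets[of X] by blast
    show "Card_order r" if "r \<in> ?R" for r
      using that card_of_Card_order by fast
  qed
  then obtain \<B> where "base_of X \<B>" and "least_card ?R = |Inl ` \<B> :: ('a set + nat) set|"
    by (elim CollectE exE conjE)
  moreover have "weight X = least_card ?R"
    using assms by (simp only: weight_def if_False)
  ultimately show thesis
    using that by metis
qed

lemma Card_order_weight: "Card_order (weight X)" for X :: "'a topology"
proof (cases "finite (topspace X)")
  case True
  then show ?thesis
    by (simp add: weight_def card_of_Card_order)
next
  case False
  then obtain \<B> where "weight X = |Inl ` \<B> :: ('a set + nat) set|"
    using weight_attained by blast
  then show ?thesis
    by (simp only: card_of_Card_order)
qed

lemma card_of_range_Inr_nat:
  "|range (Inr :: nat \<Rightarrow> 'b + nat)| \<le>o natLeq"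
  "natLeq \<le>o |range (Inr :: nat \<Rightarrow> 'b + nat)|"
proof -
  have "|range (Inr :: nat \<Rightarrow> 'b + nat)| \<le>o |UNIV :: nat set|"
    by (rule card_of_image)
  then show "|range (Inr :: nat \<Rightarrow> 'b + nat)| \<le>o natLeq"
    using card_of_nat ordLeq_ordIso_trans by blast
  have "infinite (range (Inr :: nat \<Rightarrow> 'b + nat))"
    by (simp add: finite_image_iff)
  then show "natLeq \<le>o |range (Inr :: nat \<Rightarrow> 'b + nat)|"
    using infinite_iff_natLeq_ordLeq by blast
qed

lemma weight_finite_space:
  assumes "finite (topspace X)"
  shows "weight X \<le>o natLeq"
  using assms card_of_range_Inr_nat(1) by (simp add: weight_def)

text \<open>
  In a \<open>T\<^sub>1\<close> space a point is determined by the base sets that contain it, so a base with \<open>n\<close>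
  elements allows at most \<open>2\<^sup>n\<close> points.
\<close>

lemma infinite_base_of_t1_space:
  assumes "base_of X \<B>" and "t1_space X" and "infinite (topspace X)"
  shows "infinite \<B>"
proof
  assume fin: "finite \<B>"
  have "inj_on (\<lambda>x. {V \<in> \<B>. x \<in> V}) (topspace X)"
  proof (rule inj_onI, rule ccontr)
    fix x y
    assume xy: "x \<in> topspace X" "y \<in> topspace X" "{V \<in> \<B>. x \<in> V} = {V \<in> \<B>. y \<in> V}" "x \<noteq> y"
    then obtain U where "openin X U" "x \<in> U" "y \<notin> U"
      using \<open>t1_space X\<close> unfolding t1_space_def by metis
    then obtain V where "V \<in> \<B>" "x \<in> V" "V \<subseteq> U"
      using \<open>base_of X \<B>\<close> unfolding base_of_def by blast
    then show False
      using xy(3) \<open>y \<notin> U\<close> by blast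
  qed
  moreover have "finite ((\<lambda>x. {V \<in> \<B>. x \<in> V}) ` topspace X)"
    by (rule finite_subset[of _ "Pow \<B>"]) (use fin in auto)
  ultimately show False
    using \<open>infinite (topspace X)\<close> finite_imageD by blast
qed

lemma natLeq_ordLeq_weight:
  fixes X :: "'a topology"
  assumes "t1_space X"
  shows "natLeq \<le>o weight X"
proof (cases "finite (topspace X)")
  case True
  then show ?thesis
    using card_of_range_Inr_nat(2) by (simp add: weight_def)
next
  case False
  then obtain \<B> where "base_of X \<B>" and w: "weight X = |Inl ` \<B> :: ('a set + nat) set|"
    using weight_attained by blast
  then have "infinite (Inl ` \<B> :: ('a set + nat) set)"
    using infinite_base_of_t1_space assms False by (simp add: finite_image_iff)
  then show ?thesis
    unfolding w using infinite_iff_natLeq_ordLeq by blast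
qed

lemma Cinfinite_weight:
  assumes "t1_space X"
  shows "Cinfinite (weight X)"
  using assms natLeq_ordLeq_weight cinfinite_mono natLeq_cinfinite Card_order_weight by blast

text \<open>
  With its conventional weight \<open>\<aleph>\<^sub>0\<close>, a finite space also has a base no larger than its weight:
  it has only finitely many open sets. This and \<open>weight_ordLeq\<close> below are the two sides of the
  definition of the weight, freed from the case distinction.
\<close>

lemma obtain_base_le_weight:
  fixes X :: "'a topology"
  assumes "t1_space X"
  obtains \<B> where "base_of X \<B>" and "|\<B>| \<le>o weight X"
proof (cases "finite (topspace X)")
  case True
  have "finite {U. openin X U}"
    by (rule finite_subset[of _ "Pow (topspace X)"]) (use True openin_subset in auto)
  then have "|{U. openin X U}| \<le>o natLeq"
    using finite_iff_ordLess_natLeq ordLess_imp_ordLeq by blast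
  then have "|{U. openin X U}| \<le>o weight X"
    using natLeq_ordLeq_weight[OF assms] ordLeq_transitive by blast
  with base_of_open_sets that show thesis
    by blast
next
  case False
  then obtain \<B> where b: "base_of X \<B>" and w: "weight X = |Inl ` \<B> :: ('a set + nat) set|"
    using weight_attained by blast
  have "|\<B>| \<le>o weight X"
    unfolding w card_of_ordLeq[symmetric] by (intro exI[of _ Inl]) auto
  with b that show thesis
    by blast
qed

lemma weight_ordLeq:
  assumes "base_of X \<B>" and "|\<B>| \<le>o r" and "Cinfinite r"
  shows "weight X \<le>o r"
proof (cases "finite (topspace X)")
  case True
  then show ?thesis
    using weight_finite_space natLeq_ordLeq_cinfinite[OF assms(3)] ordLeq_transitive by blast
next
  case False
  let ?R = "{|Inl ` \<B> :: ('a set + nat) set| |\<B>. base_of X \<B>}"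
  have "least_card ?R \<le>o |Inl ` \<B> :: ('a set + nat) set|"
  proof (rule least_card(2))
    show "|Inl ` \<B> :: ('a set + nat) set| \<in> ?R"
      using assms(1) by blast
    show "Card_order s" if "s \<in> ?R" for s
      using that card_of_Card_order by fast
  qed (use assms(1) in blast)
  then show ?thesis
    using False ordLeq_transitive[OF _ ordLeq_transitive[OF card_of_image assms(2)]]
    by (simp add: weight_def)
qed

lemma embedding_imp_continuous_map:
  "embedding_map X Y f \<Longrightarrow> continuous_map X Y f"
  unfolding embedding_map_def
  using continuous_map_into_fulltopology homeomorphic_imp_continuous_map by blast

lemma embedding_map_inclusion: "embedding_map (subtopology X S) X id"
  unfolding embedding_map_def by (simp add: subtopology_restrict)

lemma embedding_map_from_subtopology:
  assumes "embedding_map X Y f"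
  shows "embedding_map (subtopology X S) Y f"
  using embedding_map_compose[OF embedding_map_inclusion assms] by simp

lemma base_of_embedding:
  assumes f: "embedding_map X Y f" and "base_of Y \<B>"
  shows "base_of X ((\<lambda>V. {x \<in> topspace X. f x \<in> V}) ` \<B>)"
  unfolding base_of_def
proof (intro conjI ballI allI impI)
  have cont: "continuous_map X Y f"
    using f embedding_imp_continuous_map by blast
  show "openin X V" if mem: "V \<in> (\<lambda>V. {x \<in> topspace X. f x \<in> V}) ` \<B>" for V
  proof -
    obtain W where "W \<in> \<B>" and V: "V = {x \<in> topspace X. f x \<in> W}"
      using mem by blast
    then have "openin Y W"
      using assms(2) unfolding base_of_def by blast
    then show ?thesis
      unfolding V by (rule openin_continuous_map_preimage[OF cont])
  qed
  fix U x
  assume "openin X U \<and> x \<in> U"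
  then have U: "openin X U" and x: "x \<in> U"
    by auto
  note UX = openin_subset[OF U]
  have hom: "homeomorphic_map X (subtopology Y (f ` topspace X)) f"
    using f by (simp add: embedding_map_def)
  then have "openin (subtopology Y (f ` topspace X)) (f ` U)"
    using homeomorphic_map_openness[OF hom UX] U by simp
  then obtain T where "openin Y T" and T: "f ` U = T \<inter> f ` topspace X"
    unfolding openin_subtopology by metis
  moreover have "f x \<in> T"
    using T x by blast
  ultimately obtain V where V: "V \<in> \<B>" "f x \<in> V" "V \<subseteq> T"
    using assms(2) unfolding base_of_def by meson
  have inj: "inj_on f (topspace X)"
    using hom by (simp add: homeomorphic_map_def)
  have "y \<in> U" if "y \<in> topspace X" "f y \<in> V" for y
  proof -
    have "f y \<in> f ` U"
      using that V(3) unfolding T by blast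
    then show ?thesis
      using inj_on_image_mem_iff[OF inj that(1) UX] by simp
  qed
  then have "{x \<in> topspace X. f x \<in> V} \<subseteq> U"
    by blast
  moreover have "x \<in> {x \<in> topspace X. f x \<in> V}"
    using x UX V(2) by blast
  ultimately show "\<exists>V\<in>(\<lambda>V. {x \<in> topspace X. f x \<in> V}) ` \<B>. x \<in> V \<and> V \<subseteq> U"
    using V(1) by blast
qed

lemma weight_embedding:
  assumes "embedding_map X Y f" and "t1_space Y"
  shows "weight X \<le>o weight Y"
proof -
  obtain \<B> where "base_of Y \<B>" and "|\<B>| \<le>o weight Y"
    by (rule obtain_base_le_weight[OF assms(2)])
  show ?thesis
  proof (rule weight_ordLeq[OF base_of_embedding[OF assms(1) \<open>base_of Y \<B>\<close>]])
    show "|(\<lambda>V. {x \<in> topspace X. f x \<in> V}) ` \<B>| \<le>o weight Y"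
      using card_of_image \<open>|\<B>| \<le>o weight Y\<close> by (rule ordLeq_transitive)
    show "Cinfinite (weight Y)"
      using assms(2) by (rule Cinfinite_weight)
  qed
qed

text \<open>
  The finite subsets are counted by size: those with \<open>n + 1\<close> elements arise by inserting a point
  into one with \<open>n\<close> elements, and \<open>r \<cdot> r = r\<close> for an infinite cardinal \<open>r\<close>.
\<close>

lemma card_of_Fpow_ordLeq:
  assumes "|S| \<le>o r" and r: "Cinfinite r"
  shows "|Fpow S| \<le>o r"
proof -
  have "|{F \<in> Fpow S. card F = n}| \<le>o r" for n
  proof (induction n)
    case 0
    have "|{F \<in> Fpow S. card F = 0}| \<le>o |{{}} :: 'a set set|"
      by (rule card_of_mono1) (auto simp: Fpow_def)
    moreover have "|{{}} :: 'a set set| \<le>o r"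
      using r by (intro Card_order_singl_ordLeq) (auto simp: cinfinite_def)
    ultimately show ?case
      by (rule ordLeq_transitive)
  next
    case (Suc n)
    have "{F \<in> Fpow S. card F = Suc n} \<subseteq> (\<lambda>(x, F). insert x F) ` (S \<times> {F \<in> Fpow S. card F = n})"
    proof
      fix F
      assume F: "F \<in> {F \<in> Fpow S. card F = Suc n}"
      then obtain x G where "F = insert x G" "x \<notin> G" "card G = n"
        by (auto simp: card_Suc_eq)
      with F show "F \<in> (\<lambda>(x, F). insert x F) ` (S \<times> {F \<in> Fpow S. card F = n})"
        by (auto simp: Fpow_def intro!: image_eqI[of _ _ "(x, G)"])
    qed
    then have "|{F \<in> Fpow S. card F = Suc n}| \<le>o |S \<times> {F \<in> Fpow S. card F = n}|"
      by (rule ordLeq_transitive[OF card_of_mono1 card_of_image])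
    moreover have "|S \<times> {F \<in> Fpow S. card F = n}| \<le>o r"
      using assms Suc r unfolding cinfinite_def by (intro card_of_Times_ordLeq_infinite_Field) auto
    ultimately show ?case
      by (rule ordLeq_transitive)
  qed
  moreover have "|UNIV :: nat set| \<le>o r"
    using natLeq_ordLeq_cinfinite[OF r] card_of_nat ordIso_ordLeq_trans by blast
  ultimately have "|\<Union>n. {F \<in> Fpow S. card F = n}| \<le>o r"
    using r by (intro UNION_Cinfinite_bound) auto
  moreover have "(\<Union>n. {F \<in> Fpow S. card F = n}) = Fpow S"
    by blast
  ultimately show ?thesis
    by simp
qed


section \<open>Weight of products\<close>

text \<open>
  A basic open box restricts finitely many coordinates, each to a base set of its factor. The finite
  set of pairs (coordinate, base set) encodes the box, which is what allows the boxes to be counted.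
\<close>

lemma base_of_product_topology:
  assumes base: "\<And>j. j \<in> J \<Longrightarrow> base_of (X j) (\<B> j)"
  shows "base_of (product_topology X J)
    ((\<lambda>F. {x \<in> topspace (product_topology X J). \<forall>(j, V)\<in>F. x j \<in> V}) ` Fpow (SIGMA j:J. \<B> j))"
    (is "base_of ?P (?box ` _)")
  unfolding base_of_def
proof (intro conjI ballI allI impI)
  have "openin ?P (?box F)" if "finite F" "F \<subseteq> (SIGMA j:J. \<B> j)" for F
    using that
  proof (induction F)
    case empty
    then show ?case
      using openin_topspace[of ?P] by (simp del: topspace_product_topology)
  next
    case (insert a F)
    obtain j V where a: "a = (j, V)"
      by fastforce
    then have "V \<in> \<B> j" and "j \<in> J"
      using insert.prems by auto
    then have "openin (X j) V"
      using base[OF \<open>j \<in> J\<close>] unfolding base_of_def by blast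
    then have "openin ?P {x \<in> topspace ?P. x j \<in> V}"
      using \<open>j \<in> J\<close> by (intro openin_continuous_map_preimage[OF continuous_map_product_projection])
    moreover have "?box (insert a F) = {x \<in> topspace ?P. x j \<in> V} \<inter> ?box F"
      using a by auto
    ultimately show ?case
      using insert.IH insert.prems by (simp only: insert_subset openin_Int)
  qed
  then show "openin ?P B" if "B \<in> ?box ` Fpow (SIGMA j:J. \<B> j)" for B
    using that by (auto simp: Fpow_def simp del: topspace_product_topology)
  fix U x
  assume "openin ?P U \<and> x \<in> U"
  then have U: "openin ?P U" and "x \<in> U"
    by auto
  then obtain W where fin: "finite {j \<in> J. W j \<noteq> topspace (X j)}"
    and W: "\<And>j. j \<in> J \<Longrightarrow> openin (X j) (W j)" and x: "x \<in> Pi\<^sub>E J W" and sub: "Pi\<^sub>E J W \<subseteq> U"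
    unfolding openin_product_topology_alt by meson
  have "\<exists>V. V \<in> \<B> j \<and> x j \<in> V \<and> V \<subseteq> W j" if "j \<in> J" for j
    using W[OF that] PiE_mem[OF x that] base[OF that] unfolding base_of_def by meson
  then obtain V where V: "\<And>j. j \<in> J \<Longrightarrow> V j \<in> \<B> j \<and> x j \<in> V j \<and> V j \<subseteq> W j"
    by metis
  \<comment> \<open>Coordinates with \<open>W j = topspace (X j)\<close> impose no condition and are left out, which makes the set finite.\<close>
  let ?F = "(\<lambda>j. (j, V j)) ` {j \<in> J. W j \<noteq> topspace (X j)}"
  have "?F \<in> Fpow (SIGMA j:J. \<B> j)"
    using fin V by (auto simp: Fpow_def)
  moreover have "x \<in> ?box ?F"
    using V subsetD[OF openin_subset[OF U] \<open>x \<in> U\<close>] by (auto simp del: topspace_product_topology)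
  moreover have "?box ?F \<subseteq> U"
  proof
    fix y
    assume y: "y \<in> ?box ?F"
    have "y j \<in> W j" if "j \<in> J" for j
    proof (cases "W j = topspace (X j)")
      case True
      then show ?thesis
        using y that by (auto simp: PiE_def Pi_def)
    next
      case False
      then have "y j \<in> V j"
        using y that by auto
      then show ?thesis
        using V[OF that] by blast
    qed
    then have "y \<in> Pi\<^sub>E J W"
      using y by (simp add: PiE_def Pi_def)
    then show "y \<in> U"
      using sub by blast
  qed
  ultimately show "\<exists>V\<in>?box ` Fpow (SIGMA j:J. \<B> j). x \<in> V \<and> V \<subseteq> U"
    by (intro bexI[of _ "?box ?F"] conjI imageI)
qed

text \<open>
  The boxes are indexed by finite subsets of a set of cardinality at most \<open>|J| \<cdot> r\<close>, and passing to
  finite subsets does not increase an infinite cardinality.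
\<close>

lemma weight_product_topology:
  assumes "J \<noteq> {}" and r: "Cinfinite r"
    and t1: "\<And>j. j \<in> J \<Longrightarrow> t1_space (X j)" and le: "\<And>j. j \<in> J \<Longrightarrow> weight (X j) \<le>o r"
  shows "weight (product_topology X J) \<le>o |J| *c r"
proof -
  have "\<exists>\<B>. base_of (X j) \<B> \<and> |\<B>| \<le>o r" if j: "j \<in> J" for j
  proof -
    obtain \<B> where "base_of (X j) \<B>" and "|\<B>| \<le>o weight (X j)"
      by (rule obtain_base_le_weight[OF t1[OF j]])
    then show ?thesis
      using ordLeq_transitive[OF _ le[OF j]] by blast
  qed
  then obtain \<B> where base: "\<And>j. j \<in> J \<Longrightarrow> base_of (X j) (\<B> j)" and card: "\<And>j. j \<in> J \<Longrightarrow> |\<B> j| \<le>o r"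
    by metis
  have J: "Cnotzero |J|"
    using \<open>J \<noteq> {}\<close> by (simp add: card_of_Card_order card_of_ordIso_czero_iff_empty)
  have "\<forall>j\<in>J. |\<B> j| \<le>o |Field r|"
    using card r ordLeq_ordIso_trans[OF _ ordIso_symmetric[OF card_of_Field_ordIso]] by blast
  then have "|SIGMA j:J. \<B> j| \<le>o |J \<times> Field r|"
    by (rule card_of_Sigma_mono1)
  then have "|SIGMA j:J. \<B> j| \<le>o |J| *c r"
    by (simp add: cprod_def Field_card_of)
  then have "|Fpow (SIGMA j:J. \<B> j)| \<le>o |J| *c r"
    by (rule card_of_Fpow_ordLeq[OF _ Cinfinite_cprod2[OF J r]])
  then show ?thesis
    by (intro weight_ordLeq[OF base_of_product_topology[OF base] _ Cinfinite_cprod2[OF J r]]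
        ordLeq_transitive[OF card_of_image])
qed


section \<open>Compact weight\<close>

lemma
  shows Card_order_compact_weight: "Card_order (compact_weight X)"
    and weight_ordLeq_compact_weight:
      "compactin X K \<Longrightarrow> weight (subtopology X K) \<le>o compact_weight X"
    and compact_weight_least:
      "Card_order r \<Longrightarrow> (\<And>K. compactin X K \<Longrightarrow> weight (subtopology X K) \<le>o r)
        \<Longrightarrow> compact_weight X \<le>o r"
proof -
  let ?R = "{weight (subtopology X K) |K. compactin X K}"
  have R: "\<And>s. s \<in> ?R \<Longrightarrow> Card_order s"
    using Card_order_weight by fast
  show "Card_order (compact_weight X)"
    unfolding compact_weight_def using R by (rule Card_order_card_sup)
  show "compactin X K \<Longrightarrow> weight (subtopology X K) \<le>o compact_weight X"
    unfolding compact_weight_def by (rule card_sup_upper[OF R]) fast+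
  show "Card_order r \<Longrightarrow> (\<And>K. compactin X K \<Longrightarrow> weight (subtopology X K) \<le>o r)
        \<Longrightarrow> compact_weight X \<le>o r"
    unfolding compact_weight_def by (rule card_sup_least[OF R]) fast+
qed

text \<open>
  The empty compact set already contributes \<open>\<aleph>\<^sub>0\<close>, the weight assigned to finite spaces.
\<close>

lemma Cinfinite_compact_weight: "Cinfinite (compact_weight X)"
proof -
  have "t1_space (subtopology X {})"
    by (simp add: t1_space_def)
  then have "natLeq \<le>o compact_weight X"
    using natLeq_ordLeq_weight weight_ordLeq_compact_weight[OF compactin_empty] ordLeq_transitive by blast
  then show ?thesis
    using Card_order_compact_weight cinfinite_mono natLeq_cinfinite by blast
qed

text \<open>
  An embedding carries each compact set \<open>K\<close> homeomorphically onto a compact set of the same weight.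
\<close>

lemma compact_weight_embedding:
  assumes f: "embedding_map X Y f" and "t1_space Y"
  shows "compact_weight X \<le>o compact_weight Y"
proof (rule compact_weight_least[OF Card_order_compact_weight])
  fix K
  assume K: "compactin X K"
  then have "compactin Y (f ` K)"
    using f embedding_imp_continuous_map image_compactin by blast
  moreover have "weight (subtopology X K) \<le>o weight (subtopology Y (f ` K))"
  proof (rule weight_embedding)
    have "embedding_map (subtopology X K) Y f"
      using f K embedding_map_from_subtopology compactin_subset_topspace by blast
    then show "embedding_map (subtopology X K) (subtopology Y (f ` K)) f"
      by (auto simp: embedding_map_in_subtopology)
    show "t1_space (subtopology Y (f ` K))"
      using assms(2) by (rule t1_space_subtopology)
  qed
  ultimately show "weight (subtopology X K) \<le>o compact_weight Y"
    using weight_ordLeq_compact_weight ordLeq_transitive by blast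
qed

text \<open>
  Each factor sits in the product as the slice through a base point \<open>c\<close>; the projection is a left
  inverse of this inclusion.
\<close>

lemma embedding_map_into_product:
  assumes "j \<in> J" and c: "\<And>i. i \<in> J \<Longrightarrow> c i \<in> topspace (X i)"
  shows "embedding_map (X j) (product_topology X J) (\<lambda>x. \<lambda>i\<in>J. if i = j then x else c i)"
proof (rule section_imp_embedding_map)
  let ?e = "\<lambda>x. \<lambda>i\<in>J. if i = j then x else c i"
  have "continuous_map (X j) (product_topology X J) ?e"
    using c by (auto simp: continuous_map_componentwise)
  moreover have "continuous_map (product_topology X J) (X j) (\<lambda>x. x j)"
    using \<open>j \<in> J\<close> by (rule continuous_map_product_projection)
  moreover have "?e x j = x" for x
    using \<open>j \<in> J\<close> by simp
  ultimately show "section_map (X j) (product_topology X J) ?e"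
    unfolding section_map_def retraction_maps_def by (intro exI[of _ "\<lambda>x. x j"]) auto
qed

text \<open>
  A compact set \<open>K\<close> lies in the product of its projections, which are compact. So it suffices to bound
  the weight of a product of compact subspaces of the factors, and weight is monotone under embeddings.
\<close>

lemma compact_weight_product_topology:
  assumes "J \<noteq> {}" and t1_X: "\<And>j. j \<in> J \<Longrightarrow> t1_space (X j)"
    and r: "Cinfinite r" and le: "\<And>j. j \<in> J \<Longrightarrow> compact_weight (X j) \<le>o r"
  shows "compact_weight (product_topology X J) \<le>o |J| *c r"
proof (rule compact_weight_least[OF Card_order_cprod])
  fix K
  assume K: "compactin (product_topology X J) K"
  let ?Kj = "\<lambda>j. (\<lambda>x. x j) ` K"
  let ?Q = "product_topology (\<lambda>j. subtopology (X j) (?Kj j)) J"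
  have comp: "compactin (X j) (?Kj j)" if "j \<in> J" for j
    using K continuous_map_product_projection[OF that] by (rule image_compactin)
  have t1: "t1_space (subtopology (X j) (?Kj j))" if "j \<in> J" for j
    using t1_X[OF that] by (rule t1_space_subtopology)
  have "weight (subtopology (X j) (?Kj j)) \<le>o r" if "j \<in> J" for j
    using weight_ordLeq_compact_weight[OF comp[OF that]] le[OF that] ordLeq_transitive by blast
  then have "weight ?Q \<le>o |J| *c r"
    using assms(1) r t1 by (intro weight_product_topology)
  moreover have "weight (subtopology (product_topology X J) K) \<le>o weight ?Q"
  proof (rule weight_embedding)
    have "K \<subseteq> Pi\<^sub>E J ?Kj"
      using compactin_subset_topspace[OF K] by (auto simp: PiE_def)
    then have "subtopology (product_topology X J) K = subtopology ?Q K"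
      by (metis inf.absorb2 subtopology_product_topology subtopology_subtopology)
    then show "embedding_map (subtopology (product_topology X J) K) ?Q id"
      by (metis embedding_map_inclusion)
    show "t1_space ?Q"
      using t1 by (simp add: t1_space_product_topology)
  qed
  ultimately show "weight (subtopology (product_topology X J) K) \<le>o |J| *c r"
    using ordLeq_transitive by blast
qed


section \<open>Convergence of products of maps\<close>

text \<open>
  Convergence need only be tested on a subbase. The maps \<open>f k\<close> are required to be members of
  \<^const>\<open>cont_maps\<close> because the subbasic sets contain no others.
\<close>

lemma limitin_compact_open_topologyI:
  assumes l: "l \<in> cont_maps X Y" and f: "\<And>k. f k \<in> cont_maps X Y"
    and ev: "\<And>K U. compactin X K \<Longrightarrow> openin Y U \<Longrightarrow> l ` K \<subseteq> U \<Longrightarrow> \<forall>\<^sub>F k in F. f k ` K \<subseteq> U"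
  shows "limitin (compact_open_topology X Y) f l F"
  unfolding limitin_def
proof (intro conjI allI impI)
  show "l \<in> topspace (compact_open_topology X Y)"
    using l by (simp add: topspace_compact_open_topology)
  fix W
  assume "openin (compact_open_topology X Y) W \<and> l \<in> W"
  then have "generate_topology_on {{f \<in> cont_maps X Y. f ` K \<subseteq> U} |K U. compactin X K \<and> openin Y U} W"
    and "l \<in> W"
    by (auto simp: compact_open_topology_def openin_topology_generated_by_iff)
  then show "\<forall>\<^sub>F k in F. f k \<in> W"
  proof (induction rule: generate_topology_on.induct)
    case (Int a b)
    then show ?case
      by (auto intro: eventually_conj)
  next
    case (UN C)
    then obtain c where "c \<in> C" "l \<in> c"
      by blast
    then have "\<forall>\<^sub>F k in F. f k \<in> c"
      using UN.IH by blast
    then show ?case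
      by (rule eventually_mono) (use \<open>c \<in> C\<close> in blast)
  next
    case (Basis s)
    then obtain K U where K: "compactin X K" "openin Y U" and s: "s = {f \<in> cont_maps X Y. f ` K \<subseteq> U}"
      by blast
    with Basis.prems have "\<forall>\<^sub>F k in F. f k ` K \<subseteq> U"
      by (intro ev) auto
    then show ?case
      by (rule eventually_mono) (use s f in blast)
  qed simp
qed

lemma limitin_compact_open_topologyD:
  assumes lim: "limitin (compact_open_topology X Y) f l F"
    and K: "compactin X K" and U: "openin Y U" and "l ` K \<subseteq> U"
  shows "\<forall>\<^sub>F k in F. f k ` K \<subseteq> U"
proof -
  let ?W = "{f \<in> cont_maps X Y. f ` K \<subseteq> U}"
  have "openin (compact_open_topology X Y) ?W"
    unfolding compact_open_topology_def
    by (rule topology_generated_by_Basis) (use K U in blast)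
  moreover have "l \<in> cont_maps X Y"
    using lim by (simp add: limitin_def topspace_compact_open_topology)
  then have "l \<in> ?W"
    using \<open>l ` K \<subseteq> U\<close> by simp
  ultimately have "\<forall>\<^sub>F k in F. f k \<in> ?W"
    by (rule limitinD[OF lim])
  then show ?thesis
    by (rule eventually_mono) blast
qed

text \<open>
  Products of maps are made \<^const>\<open>undefined\<close> outside the product space, as membership in
  \<^const>\<open>cont_maps\<close> demands.
\<close>

definition product_map :: "'j set \<Rightarrow> ('j \<Rightarrow> 'a topology) \<Rightarrow> ('j \<Rightarrow> 'a \<Rightarrow> 'b) \<Rightarrow> ('j \<Rightarrow> 'a) \<Rightarrow> 'j \<Rightarrow> 'b" where
  "product_map J X g = (\<lambda>x\<in>topspace (product_topology X J). \<lambda>j\<in>J. g j (x j))"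

lemma product_map_apply:
  "x \<in> topspace (product_topology X J) \<Longrightarrow> product_map J X g x = (\<lambda>j\<in>J. g j (x j))"
  by (simp add: product_map_def)

lemma product_map_in_cont_maps:
  assumes "\<And>j. j \<in> J \<Longrightarrow> g j \<in> cont_maps (X j) (Y j)"
  shows "product_map J X g \<in> cont_maps (product_topology X J) (product_topology Y J)"
proof -
  have "continuous_map (product_topology X J) (product_topology Y J) (\<lambda>x. \<lambda>j\<in>J. g j (x j))"
    unfolding continuous_map_componentwise
  proof (intro conjI ballI)
    fix j
    assume j: "j \<in> J"
    have "continuous_map (product_topology X J) (Y j) (g j \<circ> (\<lambda>x. x j))"
      using assms[OF j] continuous_map_compose[OF continuous_map_product_projection[OF j]]
      by (auto simp: cont_maps_def)
    then show "continuous_map (product_topology X J) (Y j) (\<lambda>x. (\<lambda>j\<in>J. g j (x j)) j)"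
      using j by (simp add: o_def)
  qed auto
  then have "continuous_map (product_topology X J) (product_topology Y J) (product_map J X g)"
    by (rule continuous_map_eq) (simp only: product_map_apply)
  then show ?thesis
    unfolding cont_maps_def by (simp add: product_map_def)
qed

lemma image_product_map:
  "product_map J X g ` topspace (product_topology X J) = (\<Pi>\<^sub>E j\<in>J. g j ` topspace (X j))"
proof
  show "product_map J X g ` topspace (product_topology X J) \<subseteq> (\<Pi>\<^sub>E j\<in>J. g j ` topspace (X j))"
    by (auto simp: product_map_def)
  show "(\<Pi>\<^sub>E j\<in>J. g j ` topspace (X j)) \<subseteq> product_map J X g ` topspace (product_topology X J)"
  proof
    fix y
    assume y: "y \<in> (\<Pi>\<^sub>E j\<in>J. g j ` topspace (X j))"
    then have "\<exists>x. x \<in> topspace (X j) \<and> y j = g j x" if "j \<in> J" for j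
      using PiE_mem[OF y that] by blast
    then obtain x where x: "\<And>j. j \<in> J \<Longrightarrow> x j \<in> topspace (X j) \<and> y j = g j (x j)"
      by metis
    have mem: "restrict x J \<in> topspace (product_topology X J)"
      using x by auto
    have "y = (\<lambda>j\<in>J. g j (restrict x J j))"
      using y x by (intro extensionalityI[of _ J]) (auto simp: PiE_def)
    then show "y \<in> product_map J X g ` topspace (product_topology X J)"
      using mem product_map_apply[OF mem] by (metis imageI)
  qed
qed

text \<open>
  A compact Hausdorff space is regular, and closed subsets of it are compact.
\<close>

lemma compactin_compact_neighbourhood:
  assumes "Hausdorff_space X" and K: "compactin X K"
    and W: "openin (subtopology X K) W" and "x \<in> W"
  obtains N C where "openin (subtopology X K) N" and "x \<in> N" and "N \<subseteq> C" and "C \<subseteq> W"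
    and "compactin X C"
proof -
  let ?S = "subtopology X K"
  have "compact_space ?S"
    using K by (rule compact_space_subtopology)
  moreover have "Hausdorff_space ?S"
    using assms(1) by (rule Hausdorff_space_subtopology)
  ultimately have "neighbourhood_base_of (closedin ?S) ?S"
    by (simp add: compact_Hausdorff_imp_regular_space neighbourhood_base_of_closedin)
  then obtain N C where "openin ?S N" "closedin ?S C" "x \<in> N" "N \<subseteq> C" "C \<subseteq> W"
    using W \<open>x \<in> W\<close> unfolding neighbourhood_base_of by meson
  moreover have "compactin X C"
    using closedin_compact_space[OF \<open>compact_space ?S\<close> \<open>closedin ?S C\<close>]
    by (simp add: compactin_subtopology)
  ultimately show thesis
    by (intro that)
qed

text \<open>
  Suppose that the limit map sends the compact set \<open>K\<close> into the open set \<open>U\<close>. Around the image of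
  each point \<open>x\<close> of \<open>K\<close> there is a box \<open>\<Pi> W j\<close> inside \<open>U\<close>, and by regularity of \<open>K\<close> some compact
  neighbourhood \<open>C\<close> of \<open>x\<close> in \<open>K\<close> is sent into that box. For each of the finitely many coordinates \<open>j\<close>
  with \<open>W j\<close> not the whole space, the projection of \<open>C\<close> is compact, so that convergence in the factor
  \<open>j\<close> eventually sends it into \<open>W j\<close>. Finitely many of the neighbourhoods cover \<open>K\<close>.
\<close>

lemma limitin_compact_open_product_map:
  assumes haus: "\<And>j. j \<in> J \<Longrightarrow> Hausdorff_space (X j)"
    and g: "\<And>k j. j \<in> J \<Longrightarrow> g k j \<in> cont_maps (X j) (Y j)"
    and lim: "\<And>j. j \<in> J \<Longrightarrow> limitin (compact_open_topology (X j) (Y j)) (\<lambda>k. g k j) (l j) F"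
  shows "limitin (compact_open_topology (product_topology X J) (product_topology Y J))
           (\<lambda>k. product_map J X (g k)) (product_map J X l) F"
proof (rule limitin_compact_open_topologyI)
  let ?P = "product_topology X J" and ?Q = "product_topology Y J"
  have "l j \<in> cont_maps (X j) (Y j)" if "j \<in> J" for j
    using lim[OF that] by (simp add: limitin_def topspace_compact_open_topology)
  then show l: "product_map J X l \<in> cont_maps ?P ?Q"
    by (rule product_map_in_cont_maps)
  show "product_map J X (g k) \<in> cont_maps ?P ?Q" for k
    using g by (rule product_map_in_cont_maps)
  fix K U
  assume K: "compactin ?P K" and U: "openin ?Q U" and lKU: "product_map J X l ` K \<subseteq> U"
  note KP = compactin_subset_topspace[OF K]
  let ?S = "subtopology ?P K"
  have "\<exists>N. openin ?S N \<and> x \<in> N \<and> (\<forall>\<^sub>F k in F. product_map J X (g k) ` N \<subseteq> U)" if x: "x \<in> K" for x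
  proof -
    have "product_map J X l x \<in> U"
      using x lKU by blast
    then obtain W where fin: "finite {j \<in> J. W j \<noteq> topspace (Y j)}"
      and W: "\<And>j. j \<in> J \<Longrightarrow> openin (Y j) (W j)" and xW: "product_map J X l x \<in> Pi\<^sub>E J W"
      and sub: "Pi\<^sub>E J W \<subseteq> U"
      using U unfolding openin_product_topology_alt by meson
    have "openin ?Q (Pi\<^sub>E J W)"
      using fin W by (simp add: openin_PiE_gen)
    moreover have "continuous_map ?S ?Q (product_map J X l)"
      using l by (auto simp: cont_maps_def intro: continuous_map_from_subtopology)
    ultimately have opn: "openin ?S {y \<in> topspace ?S. product_map J X l y \<in> Pi\<^sub>E J W}"
      by (rule openin_continuous_map_preimage[rotated])
    have mem: "x \<in> {y \<in> topspace ?S. product_map J X l y \<in> Pi\<^sub>E J W}"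
      using x subsetD[OF KP x] xW by (simp only: topspace_subtopology Int_iff mem_Collect_eq simp_thms)
    have hausP: "Hausdorff_space ?P"
      using haus unfolding Hausdorff_space_product_topology by blast
    obtain N C where N: "openin ?S N" "x \<in> N" "N \<subseteq> C"
      and CW: "C \<subseteq> {y \<in> topspace ?S. product_map J X l y \<in> Pi\<^sub>E J W}" and C: "compactin ?P C"
      by (rule compactin_compact_neighbourhood[OF hausP K opn mem])
    note CP = compactin_subset_topspace[OF C]
    have "\<forall>\<^sub>F k in F. g k j ` (\<lambda>y. y j) ` C \<subseteq> W j" if j: "j \<in> J" for j
    proof (rule limitin_compact_open_topologyD[OF lim[OF j] _ W[OF j]])
      show "compactin (X j) ((\<lambda>y. y j) ` C)"
        using C continuous_map_product_projection[OF j] by (rule image_compactin)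
      show "l j ` (\<lambda>y. y j) ` C \<subseteq> W j"
      proof clarify
        fix y
        assume y: "y \<in> C"
        then have "product_map J X l y \<in> Pi\<^sub>E J W"
          using CW by blast
        then have "product_map J X l y j \<in> W j"
          using j by (rule PiE_mem)
        then show "l j (y j) \<in> W j"
          using j by (simp only: product_map_apply[OF subsetD[OF CP y]] restrict_apply' simp_thms)
      qed
    qed
    then have "\<forall>\<^sub>F k in F. \<forall>j\<in>{j \<in> J. W j \<noteq> topspace (Y j)}. g k j ` (\<lambda>y. y j) ` C \<subseteq> W j"
      using fin by (intro eventually_ball_finite) auto
    then have "\<forall>\<^sub>F k in F. product_map J X (g k) ` N \<subseteq> U"
    proof (rule eventually_mono)
      fix k
      assume k: "\<forall>j\<in>{j \<in> J. W j \<noteq> topspace (Y j)}. g k j ` (\<lambda>y. y j) ` C \<subseteq> W j"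
      show "product_map J X (g k) ` N \<subseteq> U"
      proof clarify
        fix y
        assume "y \<in> N"
        then have y: "y \<in> C" "y \<in> topspace ?P"
          using N(3) CP by auto
        have "g k j (y j) \<in> W j" if j: "j \<in> J" for j
        \<comment> \<open>For the remaining, possibly infinitely many, coordinates the condition holds for every \<open>k\<close>.\<close>
        proof (cases "W j = topspace (Y j)")
          case True
          have "y j \<in> topspace (X j)"
            using y(2) j unfolding topspace_product_topology by (rule PiE_mem)
          moreover have "continuous_map (X j) (Y j) (g k j)"
            using g[OF j] by (simp add: cont_maps_def)
          ultimately show ?thesis
            unfolding True using continuous_map_image_subset_topspace by blast
        next
          case False
          then have "g k j ` (\<lambda>y. y j) ` C \<subseteq> W j"
            using k j by simp
          then show ?thesis
            using y(1) by auto
        qed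
        then have "product_map J X (g k) y \<in> Pi\<^sub>E J W"
          unfolding product_map_apply[OF y(2)] by (simp add: PiE_def Pi_def)
        then show "product_map J X (g k) y \<in> U"
          using sub by blast
      qed
    qed
    with N(1,2) show ?thesis
      by (intro exI[of _ N] conjI)
  qed
  then obtain N where N: "\<And>x. x \<in> K \<Longrightarrow> openin ?S (N x) \<and> x \<in> N x \<and>
      (\<forall>\<^sub>F k in F. product_map J X (g k) ` N x \<subseteq> U)"
    by metis
  have "compactin ?S K"
    using K by (simp add: compactin_subtopology)
  moreover have "openin ?S V" if "V \<in> N ` K" for V
    using that N by auto
  moreover have "K \<subseteq> \<Union>(N ` K)"
    using N by auto
  ultimately have "\<exists>\<F>. finite \<F> \<and> \<F> \<subseteq> N ` K \<and> K \<subseteq> \<Union>\<F>"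
    by (rule compactinD)
  then obtain A where "finite A" "A \<subseteq> K" and KA: "K \<subseteq> (\<Union>x\<in>A. N x)"
    using finite_subset_image by metis
  then have "\<forall>\<^sub>F k in F. \<forall>x\<in>A. product_map J X (g k) ` N x \<subseteq> U"
    using N by (intro eventually_ball_finite) auto
  then show "\<forall>\<^sub>F k in F. product_map J X (g k) ` K \<subseteq> U"
    by (rule eventually_mono) (use KA in blast)
qed


section \<open>Products of ordered sets\<close>

definition product_order :: "'j set \<Rightarrow> ('j \<Rightarrow> 'i set) \<Rightarrow> ('j \<Rightarrow> 'i rel) \<Rightarrow> ('j \<Rightarrow> 'i) rel" where
  "product_order J I r = {(a, b). a \<in> Pi\<^sub>E J I \<and> b \<in> Pi\<^sub>E J I \<and> (\<forall>j\<in>J. (a j, b j) \<in> r j)}"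

lemma product_order_iff:
  "(a, b) \<in> product_order J I r \<longleftrightarrow> a \<in> Pi\<^sub>E J I \<and> b \<in> Pi\<^sub>E J I \<and> (\<forall>j\<in>J. (a j, b j) \<in> r j)"
  by (simp add: product_order_def)

lemma partial_order_on_product_order:
  assumes "\<And>j. j \<in> J \<Longrightarrow> partial_order_on (I j) (r j)"
  shows "partial_order_on (Pi\<^sub>E J I) (product_order J I r)"
proof -
  have r: "refl_on (I j) (r j)" "trans (r j)" "antisym (r j)" if "j \<in> J" for j
    using assms[OF that] by (simp_all add: partial_order_on_def preorder_on_def)
  have "refl_on (Pi\<^sub>E J I) (product_order J I r)"
    by (rule refl_onI) (use r(1) in \<open>auto simp: product_order_iff intro: refl_onD\<close>)
  moreover have "trans (product_order J I r)"
    by (rule transI) (use r(2) in \<open>auto simp: product_order_iff intro: transD\<close>)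
  moreover have "antisym (product_order J I r)"
  proof (rule antisymI)
    fix a b
    assume "(a, b) \<in> product_order J I r" "(b, a) \<in> product_order J I r"
    then have "a \<in> extensional J" "b \<in> extensional J" "\<And>j. j \<in> J \<Longrightarrow> (a j, b j) \<in> r j \<and> (b j, a j) \<in> r j"
      by (auto simp: product_order_iff PiE_def)
    then show "a = b"
      using r(3) by (metis antisymD extensionalityI)
  qed
  ultimately show ?thesis
    by (auto simp: partial_order_on_def preorder_on_def product_order_iff)
qed

lemma directed_product_order:
  assumes "\<And>j. j \<in> J \<Longrightarrow> directed (I j) (r j)"
  shows "directed (Pi\<^sub>E J I) (product_order J I r)"
  unfolding directed_def
proof (intro conjI ballI)
  show "Pi\<^sub>E J I \<noteq> {}"
    using assms by (auto simp: PiE_eq_empty_iff directed_def)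
  fix a b
  assume ab: "a \<in> Pi\<^sub>E J I" "b \<in> Pi\<^sub>E J I"
  have "\<exists>z. z \<in> I j \<and> (a j, z) \<in> r j \<and> (b j, z) \<in> r j" if "j \<in> J" for j
    using assms[OF that] PiE_mem[OF ab(1) that] PiE_mem[OF ab(2) that] unfolding directed_def by blast
  then obtain z where z: "\<And>j. j \<in> J \<Longrightarrow> z j \<in> I j \<and> (a j, z j) \<in> r j \<and> (b j, z j) \<in> r j"
    by metis
  show "\<exists>z\<in>Pi\<^sub>E J I. (a, z) \<in> product_order J I r \<and> (b, z) \<in> product_order J I r"
    by (rule bexI[of _ "restrict z J"]) (use z ab in \<open>auto simp: product_order_iff\<close>)
qed

text \<open>
  A subset \<open>C\<close> of the product has projections no larger than \<open>C\<close>; upper bounds of the projections,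
  chosen coordinatewise, form an upper bound of \<open>C\<close>.
\<close>

lemma long_product_order:
  assumes long: "\<And>j. j \<in> J \<Longrightarrow> long \<kappa> (I j) (r j)"
  shows "long \<kappa> (Pi\<^sub>E J I) (product_order J I r)"
  unfolding long_def
proof (intro conjI allI impI)
  show "directed (Pi\<^sub>E J I) (product_order J I r)"
    using long by (intro directed_product_order) (simp add: long_def)
  fix C
  assume C: "C \<subseteq> Pi\<^sub>E J I" and card: "|C| \<le>o \<kappa>"
  have "\<exists>u. u \<in> I j \<and> (\<forall>c\<in>C. (c j, u) \<in> r j)" if j: "j \<in> J" for j
  proof -
    have "(\<lambda>c. c j) ` C \<subseteq> I j"
      using C j by auto
    moreover have "|(\<lambda>c. c j) ` C| \<le>o \<kappa>"
      using card_of_image card by (rule ordLeq_transitive)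
    ultimately have "\<exists>u\<in>I j. \<forall>y\<in>(\<lambda>c. c j) ` C. (y, u) \<in> r j"
      using long[OF j] by (simp only: long_def)
    then show ?thesis
      by auto
  qed
  then obtain u where u: "\<And>j. j \<in> J \<Longrightarrow> u j \<in> I j \<and> (\<forall>c\<in>C. (c j, u j) \<in> r j)"
    by metis
  show "\<exists>u\<in>Pi\<^sub>E J I. \<forall>c\<in>C. (c, u) \<in> product_order J I r"
    by (rule bexI[of _ "restrict u J"]) (use u C in \<open>auto simp: product_order_iff\<close>)
qed

lemma nondecreasing_seq_component:
  assumes "nondecreasing_seq (Pi\<^sub>E J I) (product_order J I r) a" and "j \<in> J"
  shows "nondecreasing_seq (I j) (r j) (\<lambda>k. a k j)"
  using assms unfolding nondecreasing_seq_def by (auto simp: product_order_iff)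

lemma supremum_of_componentwise:
  assumes sup: "\<And>j. j \<in> J \<Longrightarrow> supremum_of (I j) (r j) ((\<lambda>a. a j) ` A) (s j)"
    and A: "A \<subseteq> Pi\<^sub>E J I"
  shows "supremum_of (Pi\<^sub>E J I) (product_order J I r) A (restrict s J)"
  unfolding supremum_of_def
proof (intro conjI ballI impI)
  show mem: "restrict s J \<in> Pi\<^sub>E J I"
    using sup by (auto simp: supremum_of_def)
  show "(a, restrict s J) \<in> product_order J I r" if "a \<in> A" for a
    using that mem A sup by (auto simp: product_order_iff supremum_of_def)
  show "(restrict s J, u) \<in> product_order J I r"
    if u: "u \<in> Pi\<^sub>E J I" and ub: "\<forall>a\<in>A. (a, u) \<in> product_order J I r" for u
  proof -
    have "(s j, u j) \<in> r j" if j: "j \<in> J" for j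
    proof -
      have "\<forall>y\<in>(\<lambda>a. a j) ` A. (y, u j) \<in> r j"
        using ub j by (auto simp: product_order_iff)
      then show ?thesis
        using sup[OF j] PiE_mem[OF u j] unfolding supremum_of_def by blast
    qed
    then show ?thesis
      using mem u by (auto simp: product_order_iff)
  qed
qed

text \<open>
  If \<open>u\<close> is an upper bound in coordinate \<open>j\<close>, then replacing the coordinate \<open>s j\<close> by \<open>u\<close> gives an
  upper bound of \<open>A\<close>, and the least upper bound \<open>s\<close> lies below it.
\<close>

lemma supremum_of_component:
  assumes sup: "supremum_of (Pi\<^sub>E J I) (product_order J I r) A s" and j: "j \<in> J"
    and refl: "\<And>i. i \<in> J \<Longrightarrow> refl_on (I i) (r i)"
  shows "supremum_of (I j) (r j) ((\<lambda>a. a j) ` A) (s j)"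
  unfolding supremum_of_def
proof (intro conjI ballI impI)
  have s: "s \<in> Pi\<^sub>E J I" and ub: "\<And>a. a \<in> A \<Longrightarrow> (a, s) \<in> product_order J I r"
    using sup by (auto simp: supremum_of_def)
  show "s j \<in> I j"
    using s j by (rule PiE_mem)
  show "(x, s j) \<in> r j" if "x \<in> (\<lambda>a. a j) ` A" for x
    using that ub j by (auto simp: product_order_iff)
  show "(s j, u) \<in> r j" if u: "u \<in> I j" and uub: "\<forall>x\<in>(\<lambda>a. a j) ` A. (x, u) \<in> r j" for u
  proof -
    have mem: "s(j := u) \<in> Pi\<^sub>E J I"
      using s u j by (auto simp: PiE_def extensional_def)
    have "(a, s(j := u)) \<in> product_order J I r" if "a \<in> A" for a
      using ub[OF that] uub that mem by (auto simp: product_order_iff)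
    then have "(s, s(j := u)) \<in> product_order J I r"
      using sup mem unfolding supremum_of_def by blast
    then show ?thesis
      using j by (auto simp: product_order_iff dest: bspec[of _ _ j])
  qed
qed

lemma omega_cpo_product_order:
  assumes cpo: "\<And>j. j \<in> J \<Longrightarrow> omega_cpo (I j) (r j)"
  shows "omega_cpo (Pi\<^sub>E J I) (product_order J I r)"
  unfolding omega_cpo_def
proof (intro conjI allI impI)
  show "partial_order_on (Pi\<^sub>E J I) (product_order J I r)"
    using cpo by (intro partial_order_on_product_order) (simp add: omega_cpo_def)
  fix a
  assume a: "nondecreasing_seq (Pi\<^sub>E J I) (product_order J I r) a"
  have "\<exists>s. supremum_of (I j) (r j) ((\<lambda>a. a j) ` range a) s" if j: "j \<in> J" for j
    using cpo[OF j] nondecreasing_seq_component[OF a j] unfolding omega_cpo_def image_image by blast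
  then obtain s where "\<And>j. j \<in> J \<Longrightarrow> supremum_of (I j) (r j) ((\<lambda>a. a j) ` range a) (s j)"
    by metis
  moreover have "range a \<subseteq> Pi\<^sub>E J I"
    using a by (simp add: nondecreasing_seq_def)
  ultimately show "\<exists>s. supremum_of (Pi\<^sub>E J I) (product_order J I r) (range a) s"
    using supremum_of_componentwise by blast
qed


section \<open>Products of socks\<close>

text \<open>
  The convergence condition of a sock takes place in maps into the image \<open>K\<^sub>\<beta>\<close> of the later retract,
  not into \<open>X\<close>. That \<open>p\<^sub>\<alpha>\<close> belongs there follows from \<open>p\<^sub>\<beta> p\<^sub>\<alpha> = p\<^sub>\<alpha>\<close>, which puts \<open>K\<^sub>\<alpha>\<close> inside \<open>K\<^sub>\<beta>\<close>.
\<close>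

lemma sock_maps_into_larger_image:
  assumes p: "sock \<kappa> X I r p" and le: "(\<alpha>, \<beta>) \<in> r" and \<alpha>: "\<alpha> \<in> I"
  shows "p \<alpha> \<in> cont_maps X (subtopology X (p \<beta> ` topspace X))"
proof -
  have "p \<alpha> \<in> retracts X" and comp: "\<And>x. x \<in> topspace X \<Longrightarrow> p \<beta> (p \<alpha> x) = p \<alpha> x"
    using p le \<alpha> unfolding sock_def by auto
  then have cont: "continuous_map X X (p \<alpha>)" and ext: "p \<alpha> \<in> extensional (topspace X)"
    by (auto simp: retracts_def cont_maps_def)
  have "p \<alpha> x \<in> p \<beta> ` topspace X" if x: "x \<in> topspace X" for x
  proof -
    have "p \<alpha> x \<in> topspace X"
      using cont x continuous_map_image_subset_topspace by blast
    then show ?thesis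
      using comp[OF x] by (metis imageI)
  qed
  then show ?thesis
    using cont ext by (simp add: cont_maps_def continuous_map_in_subtopology Pi_iff image_subset_iff)
qed

text \<open>
  The image of a product map is the product of the images. This gives compactness (by Tychonoff's
  theorem) and cofinality, because a compact set lies in the product of its projections. It also
  identifies the space in which the retracts have to converge with a product, so that convergence
  follows from that in the factors.
\<close>

lemma sock_product_topology:
  assumes haus: "\<And>j. j \<in> J \<Longrightarrow> Hausdorff_space (X j)"
    and sock: "\<And>j. j \<in> J \<Longrightarrow> sock \<kappa> (X j) (I j) (r j) (p j)"
  shows "sock \<kappa> (product_topology X J) (Pi\<^sub>E J I) (product_order J I r)
    (\<lambda>\<alpha>. product_map J X (\<lambda>j. p j (\<alpha> j)))"
proof -
  let ?P = "product_topology X J" and ?r = "product_order J I r"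
  let ?p = "\<lambda>\<alpha>. product_map J X (\<lambda>j. p j (\<alpha> j))"
  have long: "long \<kappa> (I j) (r j)" and cpo: "omega_cpo (I j) (r j)" if "j \<in> J" for j
    using sock[OF that] by (simp_all add: sock_def)
  have retr: "p j \<alpha> \<in> retracts (X j)" and compact: "compactin (X j) (p j \<alpha> ` topspace (X j))"
    if "j \<in> J" "\<alpha> \<in> I j" for j \<alpha>
    using sock[OF that(1)] that(2) by (simp_all add: sock_def)
  have comp: "p j \<beta> (p j \<alpha> x) = p j \<alpha> x" if "j \<in> J" "(\<alpha>, \<beta>) \<in> r j" "x \<in> topspace (X j)" for j \<alpha> \<beta> x
    using sock[OF that(1)] that(2,3) by (simp add: sock_def)
  have cofinal: "\<exists>\<alpha>. \<alpha> \<in> I j \<and> L \<subseteq> p j \<alpha> ` topspace (X j)" if "j \<in> J" "compactin (X j) L" for j L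
    using sock[OF that(1)] that(2) unfolding sock_def by blast
  have refl: "refl_on (I j) (r j)" if "j \<in> J" for j
    using cpo[OF that] by (simp add: omega_cpo_def partial_order_on_def preorder_on_def)
  have pcont: "?p \<alpha> \<in> cont_maps ?P ?P" if "\<alpha> \<in> Pi\<^sub>E J I" for \<alpha>
    using retr PiE_mem[OF that] by (intro product_map_in_cont_maps) (auto simp: retracts_def)
  have pcomp: "?p \<beta> (?p \<alpha> x) = ?p \<alpha> x" if ab: "(\<alpha>, \<beta>) \<in> ?r" and x: "x \<in> topspace ?P" for \<alpha> \<beta> x
  proof -
    have "?p \<alpha> x \<in> topspace ?P"
      using pcont[of \<alpha>] ab x continuous_map_image_subset_topspace[of ?P ?P]
      by (simp add: product_order_iff cont_maps_def image_subset_iff del: topspace_product_topology)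
    then have "?p \<beta> (?p \<alpha> x) = (\<lambda>j\<in>J. p j (\<beta> j) (?p \<alpha> x j))"
      by (rule product_map_apply)
    also have "\<dots> = (\<lambda>j\<in>J. p j (\<alpha> j) (x j))"
    proof (rule restrict_ext)
      fix j
      assume j: "j \<in> J"
      have "x j \<in> topspace (X j)"
        using x j unfolding topspace_product_topology by (rule PiE_mem)
      moreover have "(\<alpha> j, \<beta> j) \<in> r j"
        using ab j by (simp add: product_order_iff)
      ultimately show "p j (\<beta> j) (?p \<alpha> x j) = p j (\<alpha> j) (x j)"
        using comp[OF j] j by (simp add: product_map_apply[OF x])
    qed
    finally show ?thesis
      unfolding product_map_apply[OF x] .
  qed
  show ?thesis
    unfolding sock_def
  proof (intro conjI ballI allI impI)
    show "long \<kappa> (Pi\<^sub>E J I) ?r"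
      using long by (rule long_product_order)
    show "omega_cpo (Pi\<^sub>E J I) ?r"
      using cpo by (rule omega_cpo_product_order)
    show "?p \<alpha> \<in> retracts ?P" if \<alpha>: "\<alpha> \<in> Pi\<^sub>E J I" for \<alpha>
    proof -
      have "(\<alpha>, \<alpha>) \<in> ?r"
        using \<alpha> refl by (auto simp: product_order_iff intro: refl_onD)
      then show ?thesis
        using pcont[OF \<alpha>] pcomp unfolding retracts_def by blast
    qed
    show "compactin ?P (?p \<alpha> ` topspace ?P)" if \<alpha>: "\<alpha> \<in> Pi\<^sub>E J I" for \<alpha>
      unfolding image_product_map compactin_PiE using compact PiE_mem[OF \<alpha>] by blast
    show "?p \<beta> (?p \<alpha> x) = ?p \<alpha> x" if "(\<alpha>, \<beta>) \<in> ?r" "x \<in> topspace ?P" for \<alpha> \<beta> x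
      using that by (rule pcomp)
    show "\<exists>\<alpha>\<in>Pi\<^sub>E J I. L \<subseteq> ?p \<alpha> ` topspace ?P" if L: "compactin ?P L" for L
    proof -
      have "\<exists>\<alpha>. \<alpha> \<in> I j \<and> (\<lambda>x. x j) ` L \<subseteq> p j \<alpha> ` topspace (X j)" if j: "j \<in> J" for j
        using cofinal[OF j] image_compactin[OF L continuous_map_product_projection[OF j]] by blast
      then obtain \<alpha> where \<alpha>: "\<And>j. j \<in> J \<Longrightarrow> \<alpha> j \<in> I j \<and> (\<lambda>x. x j) ` L \<subseteq> p j (\<alpha> j) ` topspace (X j)"
        by metis
      have "L \<subseteq> (\<Pi>\<^sub>E j\<in>J. p j (restrict \<alpha> J j) ` topspace (X j))"
      proof
        fix x
        assume x: "x \<in> L"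
        then have "x \<in> topspace ?P"
          using compactin_subset_topspace[OF L] by blast
        then have "x \<in> extensional J"
          by (simp add: PiE_def)
        moreover have "x j \<in> p j (restrict \<alpha> J j) ` topspace (X j)" if "j \<in> J" for j
          using \<alpha>[OF that] x that by auto
        ultimately show "x \<in> (\<Pi>\<^sub>E j\<in>J. p j (restrict \<alpha> J j) ` topspace (X j))"
          by (simp add: PiE_def)
      qed
      moreover have "restrict \<alpha> J \<in> Pi\<^sub>E J I"
        using \<alpha> by auto
      ultimately show ?thesis
        unfolding image_product_map by blast
    qed
    show "limitin (compact_open_topology ?P (subtopology ?P (?p \<gamma> ` topspace ?P)))
        (\<lambda>k. ?p (a k)) (?p \<gamma>) sequentially"
      if "nondecreasing_seq (Pi\<^sub>E J I) ?r a \<and> supremum_of (Pi\<^sub>E J I) ?r (range a) \<gamma>" for a \<gamma>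
    proof -
      have a: "nondecreasing_seq (Pi\<^sub>E J I) ?r a" and \<gamma>: "supremum_of (Pi\<^sub>E J I) ?r (range a) \<gamma>"
        using that by auto
      have sup: "supremum_of (I j) (r j) (range (\<lambda>k. a k j)) (\<gamma> j)" if j: "j \<in> J" for j
        using supremum_of_component[OF \<gamma> j refl] by (simp add: image_image)
      show ?thesis
        unfolding image_product_map subtopology_product_topology
      proof (rule limitin_compact_open_product_map[OF haus])
        fix j
        assume j: "j \<in> J"
        show "limitin (compact_open_topology (X j) (subtopology (X j) (p j (\<gamma> j) ` topspace (X j))))
            (\<lambda>k. p j (a k j)) (p j (\<gamma> j)) sequentially"
          using sock[OF j] nondecreasing_seq_component[OF a j] sup[OF j] unfolding sock_def by blast
        have "range (\<lambda>k. a k j) \<subseteq> I j"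
          using nondecreasing_seq_component[OF a j] by (simp add: nondecreasing_seq_def)
        then show "p j (a k j) \<in> cont_maps (X j) (subtopology (X j) (p j (\<gamma> j) ` topspace (X j)))" for k
          using sup[OF j] by (intro sock_maps_into_larger_image[OF sock[OF j]]) (auto simp: supremum_of_def)
      qed
    qed
  qed
qed

theorem proposition2p8:
  fixes \<kappa> :: "'k rel" and J :: "'j set" and X :: "'j \<Rightarrow> 'a topology"
  assumes "Cinfinite \<kappa>"
    and "\<forall>j\<in>J. tychonoff_space (X j)"
    and "\<forall>j\<in>J. topspace (X j) \<noteq> {}"
  shows "card_sup {compact_weight (X j) |j. j \<in> J} \<le>o compact_weight (product_topology X J)
    \<and> (J \<noteq> {} \<longrightarrow> compact_weight (product_topology X J)
          \<le>o |J| *c card_sup {compact_weight (X j) |j. j \<in> J})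
    \<and> ((\<forall>j\<in>J. has_sock TYPE('i) \<kappa> (X j))
        \<longrightarrow> has_sock TYPE('j \<Rightarrow> 'i) \<kappa> (product_topology X J))"
proof (intro conjI impI)
  let ?P = "product_topology X J" and ?R = "{compact_weight (X j) |j. j \<in> J}"
  have haus: "Hausdorff_space (X j)" if "j \<in> J" for j
    using assms(2) that by (simp add: tychonoff_space_def)
  then have t1: "t1_space (X j)" if "j \<in> J" for j
    using that Hausdorff_imp_t1_space by blast
  have "\<exists>x. x \<in> topspace (X j)" if "j \<in> J" for j
    using assms(3) that by blast
  then obtain c where c: "\<And>j. j \<in> J \<Longrightarrow> c j \<in> topspace (X j)"
    by metis
  have R: "Card_order s" if "s \<in> ?R" for s
    using that Card_order_compact_weight by fast
  show "card_sup ?R \<le>o compact_weight ?P"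
  proof (rule card_sup_least[OF R Card_order_compact_weight])
    fix s
    assume "s \<in> ?R"
    then obtain j where j: "j \<in> J" and s: "s = compact_weight (X j)"
      by auto
    have "embedding_map (X j) ?P (\<lambda>x. \<lambda>i\<in>J. if i = j then x else c i)"
      using j c by (rule embedding_map_into_product)
    moreover have "t1_space ?P"
      using t1 by (simp add: t1_space_product_topology)
    ultimately show "s \<le>o compact_weight ?P"
      unfolding s by (rule compact_weight_embedding)
  qed
  have upper: "compact_weight (X j) \<le>o card_sup ?R" if "j \<in> J" for j
    by (rule card_sup_upper[OF R]) (use that in auto)
  show "compact_weight ?P \<le>o |J| *c card_sup ?R" if "J \<noteq> {}"
  proof (rule compact_weight_product_topology[OF that t1 _ upper])
    from that obtain j where "j \<in> J"
      by blast
    then have "cinfinite (card_sup ?R)"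
      using cinfinite_mono[OF upper] Cinfinite_compact_weight by auto
    moreover have "Card_order (card_sup ?R)"
      by (rule Card_order_card_sup) (rule R)
    ultimately show "Cinfinite (card_sup ?R)"
      by (rule conjI)
  qed
  show "has_sock TYPE('j \<Rightarrow> 'i) \<kappa> ?P" if "\<forall>j\<in>J. has_sock TYPE('i) \<kappa> (X j)"
  proof -
    have "\<forall>j\<in>J. \<exists>(I :: 'i set) r p. sock \<kappa> (X j) I r p"
      using that by (simp only: has_sock_def)
    then obtain I :: "'j \<Rightarrow> 'i set" and r p where "\<And>j. j \<in> J \<Longrightarrow> sock \<kappa> (X j) (I j) (r j) (p j)"
      by metis
    then have "sock \<kappa> ?P (Pi\<^sub>E J I) (product_order J I r) (\<lambda>\<alpha>. product_map J X (\<lambda>j. p j (\<alpha> j)))"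
      using haus by (intro sock_product_topology)
    then show ?thesis
      unfolding has_sock_def by (intro exI)
  qed
qed

end
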